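(* For all terms $X, X'$: $X \twoheadrightarrow X'$ if and only if there exists a list of terms $Xs$ with $\mathsf{srs}\,Xs$ whose first element is $X$ and whose last element is $X'$.
   Context: Let $\mathbf{var}$ be an infinite type of variables and $\mathbf{const}$ a type of constants. Terms are $\lambda$-terms with constants built from $\mathsf{Var}\,x$, $\mathsf{Ct}\,c$, $\mathsf{App}\,X\,Y$, $\mathsf{Lm}\,x\,X$, identified up to $\alpha$-equivalence ($\mathsf{Lm}\,x\,X$ binds $x$ in $X$). $X[Y/y]$ is capture-avoiding substitution. A partial function $\mathsf{Ctapp}$ from pairs of constants to terms is fixed ($\mathsf{Ctapp}\,c_1\,c_2=\mathsf{Some}\,X$ when defined with value $X$); $\mathsf{App}\,c_1\,c_2$ abbreviates $\mathsf{App}\,(\mathsf{Ct}\,c_1)\,(\mathsf{Ct}\,c_2)$. One-step reduction $\to$: least relation closed under ($\beta$) $\mathsf{App}\,(\mathsf{Lm}\,y\,X)\,Y\to X[Y/y]$; ($\delta$) $\mathsf{Ctapp}\,c_1\,c_2=\mathsf{Some}\,X$ implies $\mathsf{App}\,c_1\,c_2\to X$; (AppL) $X\to X'$ implies $\mathsf{App}\,X\,Y\to\mathsf{App}\,X'\,Y$; (AppR) $Y\to Y'$ implies $\mathsf{App}\,X\,Y\to\mathsf{App}\,X\,Y'$; ($\xi$) $X\to X'$ implies $\mathsf{Lm}\,y\,X\to\mathsf{Lm}\,y\,X'$. $\twoheadrightarrow$ is its reflexive-transitive closure. Left reduction $\to_L$: least relation closed under ($\delta$) $\mathsf{Ctapp}\,c_1\,c_2=\mathsf{Some}\,X$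 implies $\mathsf{App}\,c_1\,c_2\to_L X$; ($\beta$) $\mathsf{App}\,(\mathsf{Lm}\,y\,X)\,Y\to_L X[Y/y]$; (AppL) $X\to_L X'$ implies $\mathsf{App}\,X\,Y\to_L\mathsf{App}\,X'\,Y$; (AppR) if $X$ has the form $\mathsf{Var}\,x$ or $\mathsf{Ct}\,c$ and $Y\to_L Y'$ then $\mathsf{App}\,X\,Y\to_L\mathsf{App}\,X\,Y'$. For lists $[X_1,\dots,X_n]$ and $[Y_1,\dots,Y_m]$, $\mathsf{zipApp}$ returns $[\mathsf{App}\,X_1\,Y_1,\dots,\mathsf{App}\,X_n\,Y_1,\mathsf{App}\,X_n\,Y_2,\dots,\mathsf{App}\,X_n\,Y_m]$. The standard reduction sequence predicate $\mathsf{srs}$ on lists of terms is the least predicate with: $\mathsf{srs}\,[\mathsf{Ct}\,c]$; $\mathsf{srs}\,[\mathsf{Var}\,x]$; if $X\to_L \mathsf{hd}\,Xs$ and $\mathsf{srs}\,Xs$ then $\mathsf{srs}\,(X\cdot Xs)$ ($X$ prepended to $Xs$); if $\mathsf{srs}\,Xs$ then $\mathsf{srs}\,(\mathsf{map}\,(\mathsf{Lm}\,x)\,Xs)$; if $\mathsf{srs}\,Xs$ and $\mathsf{srs}\,Ys$ then $\mathsf{srs}\,(\mathsf{zipApp}\,Xs\,Ys)$.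
   Formalization: The formal theorem assumes that every term returned by Ctapp is closed; without this the claim fails: with Ctapp c c = Var x and x ≠ y, App (Lm x (App c c)) (Var y) reduces to Var y but no standard reduction sequence links them. *)

theory Defs
  imports "HOL-Combinatorics.Transposition" "HOL-Library.Infinite_Typeclass"
begin

section \<open>Raw terms and alpha-equivalence\<close>

datatype ('v, 'c) rtrm =
  RVar 'v | RCt 'c | RApp "('v, 'c) rtrm" "('v, 'c) rtrm" | RLm 'v "('v, 'c) rtrm"

primrec rfv :: "('v, 'c) rtrm \<Rightarrow> 'v set" where
  "rfv (RVar x) = {x}"
| "rfv (RCt c) = {}"
| "rfv (RApp X Y) = rfv X \<union> rfv Y"
| "rfv (RLm x X) = rfv X - {x}"

text \<open>Swapping acts on all occurrences of the two variables: free, bound and binding.\<close>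

primrec rswap :: "'v \<Rightarrow> 'v \<Rightarrow> ('v, 'c) rtrm \<Rightarrow> ('v, 'c) rtrm" where
  "rswap a b (RVar x) = RVar (transpose a b x)"
| "rswap a b (RCt c) = RCt c"
| "rswap a b (RApp X Y) = RApp (rswap a b X) (rswap a b Y)"
| "rswap a b (RLm x X) = RLm (transpose a b x) (rswap a b X)"

text \<open>Alpha-equivalence is the least congruence that allows a bound variable to be renamed to a
  variable that is not free in the body.  Since \<open>y\<close> is not free in \<open>X\<close>, the swapping in
  the last rule is a renaming of \<open>x\<close> to \<open>y\<close> that cannot capture.\<close>

inductive alpha :: "('v, 'c) rtrm \<Rightarrow> ('v, 'c) rtrm \<Rightarrow> bool" where
  alpha_refl: "alpha X X"
| alpha_sym: "alpha X Y \<Longrightarrow> alpha Y X"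
| alpha_trans: "alpha X Y \<Longrightarrow> alpha Y Z \<Longrightarrow> alpha X Z"
| alpha_App: "alpha X X' \<Longrightarrow> alpha Y Y' \<Longrightarrow> alpha (RApp X Y) (RApp X' Y')"
| alpha_Lm: "alpha X X' \<Longrightarrow> alpha (RLm x X) (RLm x X')"
| alpha_rename: "y \<notin> rfv X \<Longrightarrow> alpha (RLm x X) (RLm y (rswap x y X))"

lemma finite_rfv: "finite (rfv X)"
  by (induction X) auto

lemma transpose_conj:
  "transpose a b (transpose x y z) = transpose (transpose a b x) (transpose a b y) (transpose a b z)"
  using transpose_apply_commute[OF bij_transpose[of a b], of "transpose a b x" "transpose a b y" z]
  by simp

lemma rfv_rswap: "rfv (rswap a b X) = transpose a b ` rfv X"
  by (induction X)
    (simp_all del: transpose_image_eq add: image_Un image_set_diff[OF inj_transpose])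

lemma rswap_rswap: "rswap a b (rswap x y X)
    = rswap (transpose a b x) (transpose a b y) (rswap a b X)"
  by (induction X) (simp_all, (rule transpose_conj)+)

lemma rswap_same[simp]: "rswap a a X = X"
  by (induction X) simp_all

lemma rswap_invol[simp]: "rswap a b (rswap a b X) = X"
  by (induction X) simp_all

lemma rswap_commute: "rswap a b X = rswap b a X"
  by (induction X) (simp_all add: transpose_commute)

lemma alpha_rfv: "alpha X Y \<Longrightarrow> rfv X = rfv Y"
proof (induction rule: alpha.induct)
  case (alpha_rename y X x)
  then show ?case by (force simp: rfv_rswap transpose_def split: if_splits)
qed auto

lemma alpha_rswap: "alpha X Y \<Longrightarrow> alpha (rswap a b X) (rswap a b Y)"
proof (induction rule: alpha.induct)
  case (alpha_rename y X x)
  then have "transpose a b y \<notin> rfv (rswap a b X)"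
    by (auto simp: rfv_rswap inj_image_mem_iff[OF inj_transpose])
  then show ?case
    by (simp add: rswap_rswap[of a b x y] alpha.alpha_rename)
qed (simp_all add: alpha_refl alpha_App alpha_Lm, (erule alpha_sym | erule (1) alpha_trans)+)

lemma alpha_rswap_fresh: "a \<notin> rfv X \<Longrightarrow> b \<notin> rfv X \<Longrightarrow> alpha (rswap a b X) X"
proof (induction X)
  case (RLm x X)
  consider "x = a" "x = b" | "x = a" "x \<noteq> b" | "x \<noteq> a" "x = b" | "x \<noteq> a" "x \<noteq> b"
    by blast
  then show ?case
  proof cases
    case 2
    then show ?thesis using RLm.prems alpha_sym[OF alpha_rename[of b X a]] by auto
  next
    case 3
    then show ?thesis using RLm.prems alpha_sym[OF alpha_rename[of a X b]]
      by (auto simp: rswap_commute[of a b])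
  next
    case 4
    then show ?thesis using RLm by (auto intro: alpha_Lm)
  qed (auto intro: alpha_refl)
qed (auto intro: alpha_refl alpha_App)

definition Lm_match :: "'v \<Rightarrow> ('v, 'c) rtrm \<Rightarrow> 'v \<Rightarrow> ('v, 'c) rtrm \<Rightarrow> bool" where
  "Lm_match x X y Y \<longleftrightarrow> (x = y \<or> y \<notin> rfv X) \<and> alpha (rswap x y X) Y"

lemma Lm_match_sym: "Lm_match x X y Y \<Longrightarrow> Lm_match y Y x X"
proof -
  assume *: "Lm_match x X y Y"
  then have "alpha (rswap x y (rswap x y X)) (rswap x y Y)"
    unfolding Lm_match_def by (blast intro: alpha_rswap)
  then have 1: "alpha (rswap y x Y) X"
    by (simp add: rswap_commute[of y x] alpha_sym)
  have "rfv Y = transpose x y ` rfv X"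
    using * alpha_rfv unfolding Lm_match_def by (metis rfv_rswap)
  then have "x = y \<or> x \<notin> rfv Y"
    using * by (auto simp: Lm_match_def transpose_def split: if_splits)
  with 1 show ?thesis by (auto simp: Lm_match_def)
qed

lemma Lm_match_trans: "Lm_match x X y Y \<Longrightarrow> Lm_match y Y z Z \<Longrightarrow> Lm_match x X z Z"
proof -
  assume 1: "Lm_match x X y Y" and 2: "Lm_match y Y z Z"
  have fvY: "rfv Y = transpose x y ` rfv X"
    using 1 alpha_rfv unfolding Lm_match_def by (metis rfv_rswap)
  have al: "alpha (rswap y z (rswap x y X)) Z"
    using 1 2 unfolding Lm_match_def by (meson alpha_rswap alpha_trans)
  show ?thesis
  proof (cases "x = y \<or> y = z \<or> x = z")
    case True
    then consider "x = y" | "y = z" | "x = z" by blast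
    then show ?thesis
    proof cases
      case 3
      then show ?thesis using al by (simp add: Lm_match_def rswap_commute[of y z])
    qed (use 1 2 al fvY in \<open>auto simp: Lm_match_def\<close>)
  next
    case False
    have z: "z \<notin> rfv X"
    proof
      assume "z \<in> rfv X"
      then have "transpose x y z \<in> rfv Y" using fvY by blast
      then show False using False 2 by (auto simp: Lm_match_def transpose_def)
    qed
    have y: "y \<notin> rfv X" using 1 False by (auto simp: Lm_match_def)
    have "rswap y z (rswap x y X) = rswap x z (rswap y z X)"
      using False by (simp add: rswap_rswap[of y z x y])
    moreover have "alpha (rswap x z (rswap y z X)) (rswap x z X)"
      using y z by (intro alpha_rswap alpha_rswap_fresh)
    ultimately show ?thesis using z al
      by (metis Lm_match_def alpha_sym alpha_trans)
  qed
qed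

fun rmatch :: "('v, 'c) rtrm \<Rightarrow> ('v, 'c) rtrm \<Rightarrow> bool" where
  "rmatch (RVar x) (RVar y) \<longleftrightarrow> x = y"
| "rmatch (RCt c) (RCt d) \<longleftrightarrow> c = d"
| "rmatch (RApp X Y) (RApp X' Y') \<longleftrightarrow> alpha X X' \<and> alpha Y Y'"
| "rmatch (RLm x X) (RLm y Y) \<longleftrightarrow> Lm_match x X y Y"
| "rmatch _ _ \<longleftrightarrow> False"

lemma alpha_rmatch: "alpha X Y \<Longrightarrow> rmatch X Y"
proof (induction rule: alpha.induct)
  case (alpha_refl X)
  then show ?case by (cases X) (auto simp: Lm_match_def intro: alpha.alpha_refl)
next
  case (alpha_sym X Y)
  from alpha_sym.IH show ?case
    by (cases X; cases Y) (simp_all add: alpha.alpha_sym Lm_match_sym)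
next
  case (alpha_trans X Y Z)
  from alpha_trans.IH show ?case
    by (cases X; cases Y; cases Z)
      (simp_all, (blast intro: alpha.alpha_trans Lm_match_trans)+)
qed (auto simp: Lm_match_def intro: alpha.alpha_refl)

lemma alpha_RLm_iff: "alpha (RLm x X) (RLm y Y) \<longleftrightarrow> Lm_match x X y Y"
proof
  assume "Lm_match x X y Y"
  then have "alpha (RLm x X) (RLm y (rswap x y X))" "alpha (rswap x y X) Y"
    by (auto simp: Lm_match_def alpha_rename alpha_refl)
  then show "alpha (RLm x X) (RLm y Y)" by (meson alpha_Lm alpha_trans)
qed (use alpha_rmatch in force)


section \<open>Terms\<close>

quotient_type ('v, 'c) trm = "('v, 'c) rtrm" / alpha
  by (intro equivpI reflpI sympI transpI) (fact alpha_refl, erule alpha_sym, erule (1) alpha_trans)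

lift_definition Var :: "'v \<Rightarrow> ('v, 'c) trm" is RVar .
lift_definition Ct :: "'c \<Rightarrow> ('v, 'c) trm" is RCt .
lift_definition App :: "('v, 'c) trm \<Rightarrow> ('v, 'c) trm \<Rightarrow> ('v, 'c) trm" is RApp
  by (rule alpha_App)
lift_definition Lm :: "'v \<Rightarrow> ('v, 'c) trm \<Rightarrow> ('v, 'c) trm" is RLm
  by (rule alpha_Lm)
lift_definition FV :: "('v, 'c) trm \<Rightarrow> 'v set" is rfv
  by (rule alpha_rfv)
lift_definition swap :: "'v \<Rightarrow> 'v \<Rightarrow> ('v, 'c) trm \<Rightarrow> ('v, 'c) trm" is rswap
  by (rule alpha_rswap)

lemma FV_simps[simp]:
  "FV (Var x) = {x}" "FV (Ct c) = {}" "FV (App X Y) = FV X \<union> FV Y" "FV (Lm x X) = FV X - {x}"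
  by (transfer, simp)+

lemma swap_simps[simp]:
  "swap a b (Var x) = Var (transpose a b x)"
  "swap a b (Ct c) = Ct c"
  "swap a b (App X Y) = App (swap a b X) (swap a b Y)"
  "swap a b (Lm x X) = Lm (transpose a b x) (swap a b X)"
  by (transfer, simp add: alpha_refl)+

lemma trm_distinct[simp]:
  "Var x \<noteq> Ct c" "Var x \<noteq> App X Y" "Var x \<noteq> Lm y X"
  "Ct c \<noteq> Var x" "Ct c \<noteq> App X Y" "Ct c \<noteq> Lm y X"
  "App X Y \<noteq> Var x" "App X Y \<noteq> Ct c" "App X Y \<noteq> Lm y Z"
  "Lm y X \<noteq> Var x" "Lm y X \<noteq> Ct c" "Lm y Z \<noteq> App X Y"
  by (transfer, use alpha_rmatch in fastforce)+

lemma trm_inject[simp]: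
  "Var x = (Var y :: ('v, 'c) trm) \<longleftrightarrow> x = y"
  "Ct c = (Ct d :: ('v, 'c) trm) \<longleftrightarrow> c = d"
  "App X Y = App X' Y' \<longleftrightarrow> X = X' \<and> Y = (Y' :: ('v, 'c) trm)"
  by (transfer, use alpha_rmatch alpha_refl alpha_App in fastforce)+

lemma Lm_eq_iff: "Lm x X = Lm y Y \<longleftrightarrow> (x = y \<or> y \<notin> FV X) \<and> swap x y X = Y"
  by transfer (simp add: alpha_RLm_iff Lm_match_def)

lemma finite_FV[simp]: "finite (FV X)"
  by transfer (rule finite_rfv)

lemma FV_swap: "FV (swap a b X) = transpose a b ` FV X"
  by transfer (rule rfv_rswap)

lemma swap_invol[simp]: "swap a b (swap a b X) = X"
  by transfer (simp add: alpha_refl)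

lemma swap_fresh: "a \<notin> FV X \<Longrightarrow> b \<notin> FV X \<Longrightarrow> swap a b X = X"
  by transfer (rule alpha_rswap_fresh)

lemma trm_induct[case_names Var Ct App Lm]:
  assumes "\<And>x. P (Var x)" "\<And>c. P (Ct c)" "\<And>X Y. P X \<Longrightarrow> P Y \<Longrightarrow> P (App X Y)"
    "\<And>x X. P X \<Longrightarrow> P (Lm x X)"
  shows "P X"
proof -
  obtain R where X: "X = abs_trm R"
    by (metis Quotient_trm Quotient_abs_rep)
  show ?thesis
    unfolding X by (induction R) (simp_all flip: Var.abs_eq Ct.abs_eq App.abs_eq Lm.abs_eq add: assms)
qed


section \<open>Capture-avoiding substitution\<close>

text \<open>\<open>substR Y y X Z\<close> is the graph of substitution of \<open>Y\<close> for \<open>y\<close> in \<open>X\<close>.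
  In the rule for abstractions the bound variable is fresh for \<open>y\<close> and \<open>Y\<close>.  This is no
  restriction, because an abstraction can be written with infinitely many bound variables.
  The graph is total and functional (lemmas \<open>substR_total\<close> and \<open>substR_fun\<close>), and
  substitution satisfies the usual equations (\<open>subst_simps\<close> and \<open>subst_Lm\<close>).\<close>

inductive substR :: "('v, 'c) trm \<Rightarrow> 'v \<Rightarrow> ('v, 'c) trm \<Rightarrow> ('v, 'c) trm \<Rightarrow> bool"
  for Y :: "('v, 'c) trm" and y :: 'v where
  substR_eq: "substR Y y (Var y) Y"
| substR_neq: "x \<noteq> y \<Longrightarrow> substR Y y (Var x) (Var x)"
| substR_Ct: "substR Y y (Ct c) (Ct c)"
| substR_App: "substR Y y X1 Z1 \<Longrightarrow> substR Y y X2 Z2 \<Longrightarrow> substR Y y (App X1 X2) (App Z1 Z2)"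
| substR_Lm: "x \<noteq> y \<Longrightarrow> x \<notin> FV Y \<Longrightarrow> substR Y y X Z \<Longrightarrow> substR Y y (Lm x X) (Lm x Z)"

text \<open>\<open>subst X Y y\<close> is \<open>X\<close> with \<open>Y\<close> substituted for \<open>y\<close>.\<close>

definition subst :: "('v, 'c) trm \<Rightarrow> ('v, 'c) trm \<Rightarrow> 'v \<Rightarrow> ('v, 'c) trm" where
  "subst X Y y = (THE Z. substR Y y X Z)"

lemma substR_FV: "substR Y y X Z \<Longrightarrow> FV Z \<subseteq> (FV X - {y}) \<union> FV Y"
  by (induction rule: substR.induct) auto

lemma substR_swap:
  assumes "substR Y y X Z" "a \<noteq> y" "b \<noteq> y" "a \<notin> FV Y" "b \<notin> FV Y"
  shows "substR Y y (swap a b X) (swap a b Z)"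
  using assms
proof (induction rule: substR.induct)
  case substR_eq
  then show ?case by (simp add: swap_fresh substR.substR_eq)
next
  case (substR_neq x)
  then have "transpose a b x \<noteq> y" by (auto simp: transpose_def)
  then show ?case by (simp add: substR.substR_neq)
next
  case (substR_Lm x X Z)
  then have "transpose a b x \<noteq> y" "transpose a b x \<notin> FV Y" by (auto simp: transpose_def)
  with substR_Lm show ?case by (simp add: substR.substR_Lm)
qed (auto intro: substR.intros)

lemma substR_fun: "substR Y y X Z \<Longrightarrow> substR Y y X Z' \<Longrightarrow> Z = Z'"
proof (induction arbitrary: Z' rule: substR.induct)
  case substR_eq
  then show ?case by cases auto
next
  case (substR_neq x)
  from substR_neq(2,1) show ?case by cases auto
next
  case (substR_Ct c)
  then show ?case by cases auto
next
  case (substR_App X1 Z1 X2 Z2)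
  from substR_App.prems substR_App.IH show ?case by cases auto
next
  case (substR_Lm x X Z)
  from substR_Lm.prems show ?case
  proof cases
    case (substR_Lm x' X' W)
    have sw: "x = x' \<or> x' \<notin> FV X" "X' = swap x x' X"
      using substR_Lm(1) by (simp_all add: Lm_eq_iff)
    have "substR Y y (swap x x' X') (swap x x' W)"
      using substR_Lm \<open>x \<noteq> y\<close> \<open>x \<notin> FV Y\<close> by (intro substR_swap) auto
    then have "Z = swap x x' W" using sw substR_Lm.IH by simp
    then have "W = swap x x' Z" by simp
    moreover have "x = x' \<or> x' \<notin> FV Z"
      using sw(1) substR_FV[OF \<open>substR Y y X Z\<close>] substR_Lm by auto
    ultimately show ?thesis using substR_Lm by (simp add: Lm_eq_iff)
  qed auto
qed

lemma Lm_fresh_exists: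
  fixes X :: "('v::infinite, 'c) trm"
  assumes "finite A"
  obtains z where "z \<notin> A" "Lm x X = Lm z (swap x z X)"
proof -
  obtain z where "z \<notin> A \<union> FV X"
    using assms ex_new_if_finite[of "A \<union> FV X"] infinite_UNIV by auto
  then show ?thesis using that by (auto simp: Lm_eq_iff)
qed

lemma substR_total:
  fixes X Y :: "('v::infinite, 'c) trm"
  shows "\<exists>Z. substR Y y X Z"
proof -
  text \<open>The claim is strengthened to all iterated swappings of \<open>X\<close>.\<close>
  have "\<exists>Z. substR Y y (foldr (\<lambda>(a, b). swap a b) ps X) Z" for ps
  proof (induction X arbitrary: ps rule: trm_induct)
    case (Var x)
    have "\<exists>z. foldr (\<lambda>(a, b). swap a b) ps (Var x :: ('v, 'c) trm) = Var z"
      by (induction ps) auto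
    then show ?case by (metis substR_eq substR_neq)
  next
    case (Ct c)
    have "foldr (\<lambda>(a, b). swap a b) ps (Ct c :: ('v, 'c) trm) = Ct c"
      by (induction ps) auto
    then show ?case by (metis substR_Ct)
  next
    case (App X1 X2)
    have "foldr (\<lambda>(a, b). swap a b) ps (App X1 X2)
      = App (foldr (\<lambda>(a, b). swap a b) ps X1) (foldr (\<lambda>(a, b). swap a b) ps X2)"
      by (induction ps) auto
    then show ?case using App by (metis substR_App)
  next
    case (Lm x X)
    have "\<exists>x'. foldr (\<lambda>(a, b). swap a b) ps (Lm x X) = Lm x' (foldr (\<lambda>(a, b). swap a b) ps X)"
      by (induction ps) auto
    then obtain x' where 1: "foldr (\<lambda>(a, b). swap a b) ps (Lm x X)
        = Lm x' (foldr (\<lambda>(a, b). swap a b) ps X)" by blast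
    obtain z where z: "z \<notin> insert y (FV Y)" "Lm x' (foldr (\<lambda>(a, b). swap a b) ps X)
        = Lm z (swap x' z (foldr (\<lambda>(a, b). swap a b) ps X))"
      using Lm_fresh_exists[of "insert y (FV Y)"] by (metis finite_FV finite_insert)
    obtain Z where "substR Y y (foldr (\<lambda>(a, b). swap a b) ((x', z) # ps) X) Z"
      using Lm by blast
    then have "substR Y y (Lm z (swap x' z (foldr (\<lambda>(a, b). swap a b) ps X))) (Lm z Z)"
      using z(1) by (auto intro: substR_Lm)
    then show ?case using 1 z(2) by metis
  qed
  from this[of "[]"] show ?thesis by simp
qed

lemma subst_eqI: "substR Y y X Z \<Longrightarrow> subst X Y y = Z"
  unfolding subst_def by (blast intro: substR_fun)

lemma substR_subst: "substR Y y X (subst X Y y)"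
  for X Y :: "('v::infinite, 'c) trm"
  using substR_total subst_eqI by metis

lemma subst_simps[simp]:
  fixes X1 X2 Y :: "('v::infinite, 'c) trm"
  shows "subst (Var x) Y y = (if x = y then Y else Var x)"
    and "subst (Ct c) Y y = Ct c"
    and "subst (App X1 X2) Y y = App (subst X1 Y y) (subst X2 Y y)"
  by (auto intro!: subst_eqI intro: substR.intros substR_subst)

lemma subst_Lm:
  fixes X Y :: "('v::infinite, 'c) trm"
  assumes "x \<noteq> y" "x \<notin> FV Y"
  shows "subst (Lm x X) Y y = Lm x (subst X Y y)"
  using assms by (intro subst_eqI substR_Lm substR_subst)


section \<open>Reduction and standard reduction sequences\<close>

inductive step ::
  "('c \<Rightarrow> 'c \<Rightarrow> ('v, 'c) trm option) \<Rightarrow> ('v, 'c) trm \<Rightarrow> ('v, 'c) trm \<Rightarrow> bool"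
  for Ctapp :: "'c \<Rightarrow> 'c \<Rightarrow> ('v, 'c) trm option" where
  step_beta: "step Ctapp (App (Lm y X) Y) (subst X Y y)"
| step_delta: "Ctapp c1 c2 = Some X \<Longrightarrow> step Ctapp (App (Ct c1) (Ct c2)) X"
| step_AppL: "step Ctapp X X' \<Longrightarrow> step Ctapp (App X Y) (App X' Y)"
| step_AppR: "step Ctapp Y Y' \<Longrightarrow> step Ctapp (App X Y) (App X Y')"
| step_xi: "step Ctapp X X' \<Longrightarrow> step Ctapp (Lm y X) (Lm y X')"

abbreviation steps ::
  "('c \<Rightarrow> 'c \<Rightarrow> ('v, 'c) trm option) \<Rightarrow> ('v, 'c) trm \<Rightarrow> ('v, 'c) trm \<Rightarrow> bool" where
  "steps Ctapp \<equiv> (step Ctapp)\<^sup>*\<^sup>*"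

inductive lstep ::
  "('c \<Rightarrow> 'c \<Rightarrow> ('v, 'c) trm option) \<Rightarrow> ('v, 'c) trm \<Rightarrow> ('v, 'c) trm \<Rightarrow> bool"
  for Ctapp :: "'c \<Rightarrow> 'c \<Rightarrow> ('v, 'c) trm option" where
  lstep_delta: "Ctapp c1 c2 = Some X \<Longrightarrow> lstep Ctapp (App (Ct c1) (Ct c2)) X"
| lstep_beta: "lstep Ctapp (App (Lm y X) Y) (subst X Y y)"
| lstep_AppL: "lstep Ctapp X X' \<Longrightarrow> lstep Ctapp (App X Y) (App X' Y)"
| lstep_AppR: "(\<exists>x. X = Var x) \<or> (\<exists>c. X = Ct c) \<Longrightarrow> lstep Ctapp Y Y' \<Longrightarrow>
    lstep Ctapp (App X Y) (App X Y')"

text \<open>Only meant for nonempty lists; by \<open>srs_nonempty\<close> below, it is only used on those.\<close>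

definition zipApp :: "('v, 'c) trm list \<Rightarrow> ('v, 'c) trm list \<Rightarrow> ('v, 'c) trm list" where
  "zipApp Xs Ys = map (\<lambda>X. App X (hd Ys)) Xs @ map (App (last Xs)) (tl Ys)"

inductive srs :: "('c \<Rightarrow> 'c \<Rightarrow> ('v, 'c) trm option) \<Rightarrow> ('v, 'c) trm list \<Rightarrow> bool"
  for Ctapp :: "'c \<Rightarrow> 'c \<Rightarrow> ('v, 'c) trm option" where
  srs_Ct: "srs Ctapp [Ct c]"
| srs_Var: "srs Ctapp [Var x]"
| srs_Cons: "lstep Ctapp X (hd Xs) \<Longrightarrow> srs Ctapp Xs \<Longrightarrow> srs Ctapp (X # Xs)"
| srs_Lm: "srs Ctapp Xs \<Longrightarrow> srs Ctapp (map (Lm x) Xs)"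
| srs_zipApp: "srs Ctapp Xs \<Longrightarrow> srs Ctapp Ys \<Longrightarrow> srs Ctapp (zipApp Xs Ys)"

lemma srs_nonempty: "srs Ctapp Xs \<Longrightarrow> Xs \<noteq> []"
  by (induction rule: srs.induct) (auto simp: zipApp_def)

text \<open>If \<open>Ctapp\<close> may return open terms, then reduction does not commute with substitution
  and standardization fails: with \<open>Ctapp c c\<close> returning \<open>Var x\<close>, the term below reduces to
  \<open>Var y\<close> only by contracting under the abstraction over \<open>x\<close> first.  Hence the results
  of \<open>Ctapp\<close> have to be closed, as in Plotkin's definition of delta-rules.\<close>

lemma open_Ctapp_not_standardizable:
  fixes x y :: "'v::infinite" and c :: 'c
  assumes xy: "x \<noteq> y"
  defines "Ctapp \<equiv> \<lambda>_ _. Some (Var x :: ('v,'c) trm)"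
  defines "M \<equiv> App (Lm x (App (Ct c) (Ct c))) (Var y) :: ('v,'c) trm"
  shows "steps Ctapp M (Var y)"
    "\<not> (\<exists>Xs. srs Ctapp Xs \<and> hd Xs = M \<and> last Xs = Var y)"
proof -
  have "step Ctapp M (App (Lm x (Var x)) (Var y))"
    unfolding M_def by (intro step_AppL step_xi step_delta) (simp add: Ctapp_def)
  moreover have "step Ctapp (App (Lm x (Var x)) (Var y)) (Var y)"
    using step_beta[of Ctapp x "Var x" "Var y"] by simp
  ultimately show "steps Ctapp M (Var y)"
    by (meson converse_rtranclp_into_rtranclp rtranclp.rtrancl_refl)
  have noV: "\<not> lstep Ctapp (Var z) Z" for z Z by (auto elim: lstep.cases)
  have noC: "\<not> lstep Ctapp (Ct z) Z" for z Z by (auto elim: lstep.cases)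
  have noL: "\<not> lstep Ctapp (Lm z W) Z" for z Z W by (auto elim: lstep.cases)
  have cc: "lstep Ctapp (App (Ct c) (Ct c)) Z \<Longrightarrow> Z = Var x" for Z
    by (erule lstep.cases) (use noC in \<open>auto simp: Ctapp_def\<close>)
  have b: "subst X Y z = App (Ct c) (Ct c)" if e: "Lm x (App (Ct c) (Ct c)) = Lm z X"
    for z X and Y :: "('v,'c) trm"
    using e by (auto simp: Lm_eq_iff)
  have M: "lstep Ctapp M Z \<Longrightarrow> Z = App (Ct c) (Ct c)" for Z
    unfolding M_def by (erule lstep.cases) (use noL noV b in auto)
  have lastApp: "\<exists>P Q. last (zipApp Xs Ys) = App P Q" if "Xs \<noteq> []" "Ys \<noteq> []"
    for Xs Ys :: "('v,'c) trm list"
    using that by (cases "tl Ys = []") (auto simp: zipApp_def last_map)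
  have 1: "srs Ctapp Xs \<Longrightarrow> (hd Xs = Var x \<longrightarrow> last Xs \<noteq> Var y) \<and>
     (hd Xs = App (Ct c) (Ct c) \<longrightarrow> last Xs \<noteq> Var y) \<and> (hd Xs = M \<longrightarrow> last Xs \<noteq> Var y)" for Xs
  proof (induction rule: srs.induct)
    case (srs_Cons X Xs)
    then have "Xs \<noteq> []" using srs_nonempty by blast
    then show ?case using srs_Cons noV cc M by (auto; metis)
  next
    case (srs_Lm Xs z)
    then have "Xs \<noteq> []" using srs_nonempty by blast
    then show ?case by (simp add: last_map)
  next
    case (srs_zipApp Xs Ys)
    then show ?case using lastApp[of Xs Ys] srs_nonempty by (metis trm_distinct(2))
  qed (use xy in \<open>auto simp: M_def\<close>)
  then show "\<not> (\<exists>Xs. srs Ctapp Xs \<and> hd Xs = M \<and> last Xs = Var y)" by blast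
qed

end

(* Kashima's proof of standardization.  Left reduction is not stable under substitution, because
   the argument of a variable may be reduced, and that variable may be replaced by an abstraction.
   So we work with the smaller relation hstep, in which only the argument of a constant is
   reduced.  A standard reduction std X X' head-reduces X to the outermost shape of X' and then
   continues in the immediate subterms.  It is stable under substitution, hence closed under
   composition with a single reduction step on the right, and its derivations unfold to standard
   reduction sequences. *)

theory Submission
  imports Defs
begin

section \<open>Size of terms and induction with fresh bound variables\<close>

lift_definition tsize :: "('v, 'c) trm \<Rightarrow> nat" is size
proof -
  \<comment> \<open>This settles the renaming rule of \<open>alpha\<close>.\<close>
  have [simp]: "size (rswap a b X) = size X" for a b and X :: "('v, 'c) rtrm"
    by (induction X) simp_all
  show "alpha X Y \<Longrightarrow> size X = size Y" for X Y :: "('v, 'c) rtrm"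
    by (induction rule: alpha.induct) simp_all
qed

lemma tsize_App: "tsize X < tsize (App X Y)" "tsize Y < tsize (App X Y)"
  by (transfer, simp)+

lemma tsize_Lm: "tsize X < tsize (Lm x X)"
  by transfer simp

lemma tsize_swap[simp]: "tsize (swap a b X) = tsize X"
proof (induction X rule: trm_induct)
  case (Var x) show ?case by simp (transfer, simp)
next
  case (Ct c) show ?case by simp
next
  case (App X Y) then show ?case by simp (transfer, simp)
next
  case (Lm x X) then show ?case by simp (transfer, simp)
qed

lemma trm_exhaust[case_names Var Ct App Lm]:
  assumes "\<And>x. X = Var x \<Longrightarrow> P" "\<And>c. X = Ct c \<Longrightarrow> P" "\<And>Y Z. X = App Y Z \<Longrightarrow> P"
    "\<And>x Y. X = Lm x Y \<Longrightarrow> P"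
  shows P
  using assms by (induction X rule: trm_induct) blast+

text \<open>Barendregt's variable convention as an induction principle. The renamed body is a
  swapped copy of the given one, so structural induction does not reach it; induction on
  \<open>tsize\<close>, which swapping preserves, does.\<close>

lemma trm_fresh_induct[case_names finite Var Ct App Lm]:
  fixes X :: "('v::infinite, 'c) trm"
  assumes "finite A" and "\<And>x. P (Var x)" "\<And>c. P (Ct c)" "\<And>X Y. P X \<Longrightarrow> P Y \<Longrightarrow> P (App X Y)"
    and Lm: "\<And>x X. x \<notin> A \<Longrightarrow> P X \<Longrightarrow> P (Lm x X)"
  shows "P X"
proof (induction X rule: measure_induct_rule[of tsize])
  case (less X)
  show ?case
  proof (cases X rule: trm_exhaust)
    case (Lm x Y)
    obtain z where "z \<notin> A" "Lm x Y = Lm z (swap x z Y)"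
      using Lm_fresh_exists[OF \<open>finite A\<close>] by metis
    moreover have "P (swap x z Y)"
      by (rule less) (simp add: Lm tsize_Lm)
    ultimately show ?thesis using Lm assms(5) by metis
  qed (use assms less in \<open>auto simp: tsize_App\<close>)
qed

section \<open>Laws of substitution\<close>

lemma FV_subst: "FV (subst X Y y) \<subseteq> (FV X - {y}) \<union> FV Y"
  for X Y :: "('v::infinite, 'c) trm"
  by (rule substR_FV[OF substR_subst])

lemma subst_fresh: "y \<notin> FV X \<Longrightarrow> subst X Y y = X"
  for X Y :: "('v::infinite, 'c) trm"
proof (induction X rule: trm_fresh_induct[of "insert y (FV Y)"])
  case (Lm x X) then show ?case by (auto simp: subst_Lm)
qed auto

lemma swap_subst: "swap a b (subst X Y y) = subst (swap a b X) (swap a b Y) (transpose a b y)"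
  for X Y :: "('v::infinite, 'c) trm"
proof (induction X rule: trm_fresh_induct[of "insert y (FV Y)"])
  case (Lm x X)
  then have "transpose a b x \<noteq> transpose a b y" "transpose a b x \<notin> FV (swap a b Y)"
    by (auto simp: FV_swap inj_image_mem_iff[OF inj_transpose] inj_eq[OF inj_transpose]
        simp del: transpose_image_eq)
  then show ?case using Lm by (simp add: subst_Lm)
qed (auto simp: inj_eq[OF inj_transpose])

text \<open>Makes the contractum of a beta-redex independent of the name chosen for the bound
  variable.\<close>

lemma subst_rename: "z = y \<or> z \<notin> FV X \<Longrightarrow> subst (swap y z X) Y z = subst X Y y"
  for X Y :: "('v::infinite, 'c) trm"
proof (induction X rule: trm_fresh_induct[of "{y, z} \<union> FV Y"])
  case (Lm x X)
  then show ?case by (auto simp: subst_Lm transpose_def)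
qed (auto simp: transpose_def)

text \<open>The substitution lemma of the \<lambda>-calculus, by which beta-contraction commutes
  with substitution.\<close>

lemma subst_subst:
  fixes X Y Z :: "('v::infinite, 'c) trm"
  assumes "y \<noteq> z" "y \<notin> FV Z"
  shows "subst (subst X Y y) Z z = subst (subst X Z z) (subst Y Z z) y"
proof (induction X rule: trm_fresh_induct[of "{y, z} \<union> FV Y \<union> FV Z"])
  case (Lm x X)
  then have "x \<notin> FV (subst Y Z z)" using FV_subst[of Y Z z] by auto
  then show ?case using Lm by (simp add: subst_Lm)
qed (use assms in \<open>auto simp: subst_fresh\<close>)

section \<open>Head reduction and standard reductions\<close>

inductive hstep ::
  "('c \<Rightarrow> 'c \<Rightarrow> ('v, 'c) trm option) \<Rightarrow> ('v, 'c) trm \<Rightarrow> ('v, 'c) trm \<Rightarrow> bool"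
  for Ctapp :: "'c \<Rightarrow> 'c \<Rightarrow> ('v, 'c) trm option" where
  hstep_delta: "Ctapp c1 c2 = Some X \<Longrightarrow> hstep Ctapp (App (Ct c1) (Ct c2)) X"
| hstep_beta: "hstep Ctapp (App (Lm y X) Y) (subst X Y y)"
| hstep_AppL: "hstep Ctapp X X' \<Longrightarrow> hstep Ctapp (App X Y) (App X' Y)"
| hstep_AppR: "hstep Ctapp Y Y' \<Longrightarrow> hstep Ctapp (App (Ct c) Y) (App (Ct c) Y')"

abbreviation hsteps ::
  "('c \<Rightarrow> 'c \<Rightarrow> ('v, 'c) trm option) \<Rightarrow> ('v, 'c) trm \<Rightarrow> ('v, 'c) trm \<Rightarrow> bool" where
  "hsteps Ctapp \<equiv> (hstep Ctapp)\<^sup>*\<^sup>*"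

inductive std ::
  "('c \<Rightarrow> 'c \<Rightarrow> ('v, 'c) trm option) \<Rightarrow> ('v, 'c) trm \<Rightarrow> ('v, 'c) trm \<Rightarrow> bool"
  for Ctapp :: "'c \<Rightarrow> 'c \<Rightarrow> ('v, 'c) trm option" where
  std_Var: "hsteps Ctapp X (Var x) \<Longrightarrow> std Ctapp X (Var x)"
| std_Ct: "hsteps Ctapp X (Ct c) \<Longrightarrow> std Ctapp X (Ct c)"
| std_App: "hsteps Ctapp X (App P Q) \<Longrightarrow> std Ctapp P P' \<Longrightarrow> std Ctapp Q Q' \<Longrightarrow>
    std Ctapp X (App P' Q')"
| std_Lm: "hsteps Ctapp X (Lm x P) \<Longrightarrow> std Ctapp P P' \<Longrightarrow> std Ctapp X (Lm x P')"

inductive_cases std_VarE: "std Ctapp X (Var x)"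
inductive_cases std_CtE: "std Ctapp X (Ct c)"
inductive_cases std_AppE: "std Ctapp X (App P Q)"

lemma hstep_lstep: "hstep Ctapp X Y \<Longrightarrow> lstep Ctapp X Y"
  by (induction rule: hstep.induct) (auto intro: lstep.intros)

lemma lstep_step: "lstep Ctapp X Y \<Longrightarrow> step Ctapp X Y"
  by (induction rule: lstep.induct) (auto intro: step.intros)

lemma hsteps_AppL: "hsteps Ctapp X X' \<Longrightarrow> hsteps Ctapp (App X Y) (App X' Y)"
  by (induction rule: rtranclp_induct) (auto intro: hstep_AppL rtranclp.rtrancl_into_rtrancl)

lemma hsteps_AppR: "hsteps Ctapp Y Y' \<Longrightarrow> hsteps Ctapp (App (Ct c) Y) (App (Ct c) Y')"
  by (induction rule: rtranclp_induct) (auto intro: hstep_AppR rtranclp.rtrancl_into_rtrancl)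

lemma steps_AppL: "steps Ctapp X X' \<Longrightarrow> steps Ctapp (App X Y) (App X' Y)"
  by (induction rule: rtranclp_induct) (auto intro: step_AppL rtranclp.rtrancl_into_rtrancl)

lemma steps_AppR: "steps Ctapp Y Y' \<Longrightarrow> steps Ctapp (App X Y) (App X Y')"
  by (induction rule: rtranclp_induct) (auto intro: step_AppR rtranclp.rtrancl_into_rtrancl)

lemma steps_Lm: "steps Ctapp X X' \<Longrightarrow> steps Ctapp (Lm x X) (Lm x X')"
  by (induction rule: rtranclp_induct) (auto intro: step_xi rtranclp.rtrancl_into_rtrancl)

lemma std_refl: "std Ctapp X X"
  by (induction X rule: trm_induct) (auto intro: std.intros)

text \<open>Every rule of \<open>std\<close> begins with a head reduction from the source, and a
  longer one can be put in its place.\<close>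

lemma hsteps_std: "hsteps Ctapp X Y \<Longrightarrow> std Ctapp Y Z \<Longrightarrow> std Ctapp X Z"
  by (erule std.cases) (auto intro: std.intros rtranclp_trans)

section \<open>Standard reduction sequences: soundness, and their extraction from
  \<open>std\<close>\<close>

lemma hd_zipApp: "Xs \<noteq> [] \<Longrightarrow> hd (zipApp Xs Ys) = App (hd Xs) (hd Ys)"
  by (cases Xs) (auto simp: zipApp_def)

lemma last_zipApp: "Xs \<noteq> [] \<Longrightarrow> Ys \<noteq> [] \<Longrightarrow> last (zipApp Xs Ys) = App (last Xs) (last Ys)"
  by (cases Ys) (auto simp: zipApp_def last_map)

lemma srs_steps: "srs Ctapp Xs \<Longrightarrow> steps Ctapp (hd Xs) (last Xs)"
proof (induction rule: srs.induct)
  case (srs_Cons X Xs)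
  then show ?case using srs_nonempty lstep_step
    by (metis last.simps list.sel(1) converse_rtranclp_into_rtranclp)
next
  case (srs_Lm Xs x)
  then show ?case using srs_nonempty by (metis hd_map last_map steps_Lm)
next
  case (srs_zipApp Xs Ys)
  then show ?case using srs_nonempty[of Ctapp Xs] srs_nonempty[of Ctapp Ys]
    by (simp add: hd_zipApp last_zipApp) (meson rtranclp_trans steps_AppL steps_AppR)
qed auto

lemma hsteps_srs:
  assumes "hsteps Ctapp X (hd Xs)" "srs Ctapp Xs"
  shows "\<exists>Ys. srs Ctapp Ys \<and> hd Ys = X \<and> last Ys = last Xs"
  using assms(1)
proof (induction rule: converse_rtranclp_induct)
  case base
  then show ?case using assms(2) by blast
next
  case (step X Z)
  then obtain Ys where "srs Ctapp Ys" "hd Ys = Z" "last Ys = last Xs" by blast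
  then show ?case using step(1) srs_nonempty[of Ctapp Ys]
    by (intro exI[of _ "X # Ys"]) (auto intro: srs_Cons hstep_lstep)
qed

text \<open>The sequences for the immediate subterms are combined by \<open>map (Lm x)\<close> or
  \<open>zipApp\<close>; the initial head steps are then prepended one by one, each being a left
  step.\<close>

lemma std_srs: "std Ctapp X X' \<Longrightarrow> \<exists>Xs. srs Ctapp Xs \<and> hd Xs = X \<and> last Xs = X'"
proof (induction rule: std.induct)
  case (std_Var X x)
  then show ?case using hsteps_srs[of Ctapp X "[Var x]"] srs_Var by fastforce
next
  case (std_Ct X c)
  then show ?case using hsteps_srs[of Ctapp X "[Ct c]"] srs_Ct by fastforce
next
  case (std_App X P Q P' Q')
  then obtain Xs Ys where "srs Ctapp Xs" "hd Xs = P" "last Xs = P'"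
    "srs Ctapp Ys" "hd Ys = Q" "last Ys = Q'" by blast
  then show ?case using hsteps_srs[of Ctapp X "zipApp Xs Ys"] std_App(1)
    srs_nonempty[of Ctapp Xs] srs_nonempty[of Ctapp Ys]
    by (auto simp: hd_zipApp last_zipApp intro: srs_zipApp)
next
  case (std_Lm X x P P')
  then obtain Xs where "srs Ctapp Xs" "hd Xs = P" "last Xs = P'" by blast
  then show ?case using hsteps_srs[of Ctapp X "map (Lm x) Xs"] std_Lm(1)
    srs_nonempty[of Ctapp Xs] by (auto simp: hd_map last_map intro: srs_Lm)
qed

section \<open>Stability of \<open>std\<close> under swapping, substitution and single steps, for
  closed results of \<open>Ctapp\<close>\<close>

context
  fixes Ctapp :: "'c \<Rightarrow> 'c \<Rightarrow> ('v::infinite, 'c) trm option"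
  assumes closed: "\<And>c1 c2 Z. Ctapp c1 c2 = Some Z \<Longrightarrow> FV Z = {}"
begin

lemma hstep_swap: "hstep Ctapp X Y \<Longrightarrow> hstep Ctapp (swap a b X) (swap a b Y)"
  by (induction rule: hstep.induct)
    (auto simp: swap_subst swap_fresh closed intro: hstep.intros)

lemma hsteps_swap: "hsteps Ctapp X Y \<Longrightarrow> hsteps Ctapp (swap a b X) (swap a b Y)"
  by (induction rule: rtranclp_induct) (auto intro: hstep_swap rtranclp.rtrancl_into_rtrancl)

lemma std_swap: "std Ctapp X Y \<Longrightarrow> std Ctapp (swap a b X) (swap a b Y)"
proof (induction rule: std.induct)
  case (std_Var X x)
  then show ?case using hsteps_swap[of X "Var x" a b] by (simp add: std.std_Var)
next
  case (std_Ct X c)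
  then show ?case using hsteps_swap[of X "Ct c" a b] by (simp add: std.std_Ct)
next
  case (std_App X P Q P' Q')
  then show ?case using hsteps_swap[of X "App P Q" a b] by (auto intro: std.std_App)
next
  case (std_Lm X x P P')
  then show ?case using hsteps_swap[of X "Lm x P" a b] by (auto intro: std.std_Lm)
qed

text \<open>Keeps a renaming of a bound variable legitimate after a step in the body.\<close>

lemma step_FV: "step Ctapp X Y \<Longrightarrow> FV Y \<subseteq> FV X"
proof (induction rule: step.induct)
  case (step_beta y X Y)
  then show ?case using FV_subst[of X Y y] by auto
qed (auto simp: closed)

text \<open>Delta-steps survive because their results are closed, and argument steps because
  substitution leaves the constant in function position unchanged.\<close>

lemma hstep_subst: "hstep Ctapp X X' \<Longrightarrow> hstep Ctapp (subst X Y y) (subst X' Y y)"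
proof (induction rule: hstep.induct)
  case (hstep_delta c1 c2 X)
  then show ?case by (simp add: subst_fresh closed hstep.hstep_delta)
next
  case (hstep_beta x X Z)
  \<comment> \<open>Renaming the bound variable away from \<open>y\<close> and \<open>Y\<close> lets
    the substitution pass under the abstraction.\<close>
  obtain z where "z \<notin> {y} \<union> FV Y \<union> FV X"
    using ex_new_if_finite[of "{y} \<union> FV Y \<union> FV X"] infinite_UNIV by auto
  then have z: "z \<noteq> y" "z \<notin> FV Y" "Lm x X = Lm z (swap x z X)"
    "subst X Z x = subst (swap x z X) Z z"
    by (auto simp: Lm_eq_iff subst_rename)
  then show ?case
    using hstep.hstep_beta[of Ctapp z "subst (swap x z X) Y y" "subst Z Y y"]
    by (simp add: subst_Lm subst_subst)
qed (auto intro: hstep.intros)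

lemma hsteps_subst: "hsteps Ctapp X X' \<Longrightarrow> hsteps Ctapp (subst X Y y) (subst X' Y y)"
  by (induction rule: rtranclp_induct) (auto intro: hstep_subst rtranclp.rtrancl_into_rtrancl)

(* The bound variable cannot be prescribed: the source of the reduction may have more free
   variables than its target. *)
lemma std_LmE:
  assumes "std Ctapp X (Lm y Q)"
  obtains z P where "hsteps Ctapp X (Lm z P)" "std Ctapp P (swap y z Q)" "z = y \<or> z \<notin> FV Q"
  using assms
proof cases
  case (std_Lm x P P')
  then have "swap y x Q = P'" "x = y \<or> x \<notin> FV Q" by (metis Lm_eq_iff)+
  with std_Lm that show ?thesis by metis
qed auto

text \<open>Induction on the derivation would cover only the body \<open>P\<close> as given, whereas
  the abstraction case needs it with the bound variable renamed. The size of the target is unchanged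
  by that renaming.\<close>

lemma std_subst:
  assumes "std Ctapp X X'" "std Ctapp Y Y'"
  shows "std Ctapp (subst X Y y) (subst X' Y' y)"
  using assms(1)
proof (induction X' arbitrary: X rule: measure_induct_rule[of tsize])
  case (less X')
  from less.prems show ?case
  proof cases
    case (std_Var x)
    \<comment> \<open>For \<open>x = y\<close> the head reduction now ends in \<open>Y\<close>, and
      \<open>std Ctapp Y Y'\<close> continues it.\<close>
    then show ?thesis using hsteps_subst[of X "Var x" Y y] assms(2)
      by (auto intro: hsteps_std std.std_Var)
  next
    case (std_Ct c)
    then show ?thesis using hsteps_subst[of X "Ct c" Y y] by (auto intro: std.std_Ct)
  next
    case (std_App P Q P' Q')
    then show ?thesis using hsteps_subst[of X "App P Q" Y y] less.IH
      by (auto simp: tsize_App intro!: std.std_App)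
  next
    case (std_Lm x P P')
    obtain z where "z \<notin> {y} \<union> FV Y \<union> FV Y' \<union> FV P \<union> FV P'"
      using ex_new_if_finite[of "{y} \<union> FV Y \<union> FV Y' \<union> FV P \<union> FV P'"] infinite_UNIV by auto
    then have z: "z \<noteq> y" "z \<notin> FV Y" "z \<notin> FV Y'" "Lm x P = Lm z (swap x z P)"
      "X' = Lm z (swap x z P')"
      using std_Lm by (auto simp: Lm_eq_iff)
    have "std Ctapp (subst (swap x z P) Y y) (subst (swap x z P') Y' y)"
      by (rule less.IH) (simp_all add: std_Lm std_swap tsize_Lm)
    moreover have "hsteps Ctapp (subst X Y y) (Lm z (subst (swap x z P) Y y))"
      using hsteps_subst[OF std_Lm(2), of Y y] z by (simp add: subst_Lm)
    ultimately show ?thesis using z by (simp add: subst_Lm std.std_Lm)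
  qed
qed

text \<open>When the contracted redex is all of \<open>Y\<close>, inverting \<open>std\<close> shows
  that \<open>X\<close> head-reduces to a redex of the same kind, whose contraction is one more head
  step. Steps in subterms are absorbed by the derivations for those subterms.\<close>

lemma std_step: "step Ctapp Y Z \<Longrightarrow> std Ctapp X Y \<Longrightarrow> std Ctapp X Z"
proof (induction arbitrary: X rule: step.induct)
  case (step_beta y P' Q')
  from step_beta obtain M N where MN: "hsteps Ctapp X (App M N)" "std Ctapp M (Lm y P')"
    "std Ctapp N Q'" by (auto elim: std_AppE)
  from MN(2) obtain z P where z: "hsteps Ctapp M (Lm z P)" "std Ctapp P (swap y z P')"
    "z = y \<or> z \<notin> FV P'" by (rule std_LmE)
  have "hsteps Ctapp X (subst P N z)"
    using MN(1) hsteps_AppL[OF z(1)] hstep_beta by (meson rtranclp.simps rtranclp_trans)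
  moreover have "std Ctapp (subst P N z) (subst P' Q' y)"
    using std_subst[OF z(2) MN(3), of z] z(3) by (simp add: subst_rename)
  ultimately show ?case by (rule hsteps_std)
next
  case (step_delta c1 c2 Z)
  from step_delta(2) obtain M N where MN: "hsteps Ctapp X (App M N)" "hsteps Ctapp M (Ct c1)"
    "hsteps Ctapp N (Ct c2)" by (auto elim!: std_AppE std_CtE)
  \<comment> \<open>The order matters: the function part is first reduced to \<open>Ct c1\<close>,
    and only then may \<open>hstep_AppR\<close> reduce the argument to \<open>Ct c2\<close>.\<close>
  have "hsteps Ctapp X Z"
    using MN(1) hsteps_AppL[OF MN(2)] hsteps_AppR[OF MN(3)] hstep_delta[of Ctapp, OF step_delta(1)]
    by (meson rtranclp.simps rtranclp_trans)
  then show ?case using std_refl by (rule hsteps_std)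
next
  case (step_AppL P P' Q)
  from step_AppL.prems show ?case
    by (rule std_AppE) (auto intro: std_App step_AppL.IH)
next
  case (step_AppR Q Q' P)
  from step_AppR.prems show ?case
    by (rule std_AppE) (auto intro: std_App step_AppR.IH)
next
  case (step_xi Q Q' y)
  from step_xi.prems obtain z P where z: "hsteps Ctapp X (Lm z P)" "std Ctapp P (swap y z Q)"
    "z = y \<or> z \<notin> FV Q" by (rule std_LmE)
  \<comment> \<open>The induction hypothesis speaks of \<open>Q\<close> itself, so the derivation is
    swapped to reach \<open>Q\<close> and its outcome is swapped back.\<close>
  have "std Ctapp (swap y z P) Q"
    using std_swap[OF z(2), of y z] by simp
  then have "std Ctapp P (swap y z Q')"
    using std_swap[OF step_xi.IH, of "swap y z P" y z] by simp
  then have "std Ctapp X (Lm z (swap y z Q'))" using z(1) by (rule std_Lm[rotated])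
  moreover have "Lm y Q' = Lm z (swap y z Q')"
    using z(3) step_FV[OF step_xi.hyps] by (auto simp: Lm_eq_iff)
  ultimately show ?case by simp
qed

lemma steps_std: "steps Ctapp X X' \<Longrightarrow> std Ctapp X X'"
  by (induction rule: rtranclp_induct) (auto intro: std_refl std_step)

end

theorem theorem3:
  fixes Ctapp :: "'c \<Rightarrow> 'c \<Rightarrow> ('v::infinite, 'c) trm option"
    and X X' :: "('v, 'c) trm"
  assumes Ctapp_closed: "\<And>c1 c2 Z. Ctapp c1 c2 = Some Z \<Longrightarrow> FV Z = {}"
  shows "steps Ctapp X X' \<longleftrightarrow>
    (\<exists>Xs. srs Ctapp Xs \<and> hd Xs = X \<and> last Xs = X')"
proof
  assume "steps Ctapp X X'"
  then have "std Ctapp X X'" using steps_std[of Ctapp X X'] Ctapp_closed by blast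
  then show "\<exists>Xs. srs Ctapp Xs \<and> hd Xs = X \<and> last Xs = X'" by (rule std_srs)
qed (use srs_steps in blast)

end
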